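(* Let $a,b>0$, let $\alpha,\gamma$ be real exponents, and put $I(S)=aS^{\alpha}$ and $D(S)=bS^{\gamma}$. Let $\Delta(S)=\mathcal{P}_\infty-\mathcal{P}(S)$ be the national AI performance gap, and assume that there exists $q>0$ such that $$\Delta(S)\asymp\left(\frac{I(S)}{D(S)+\epsilon}\right)^{-q}.$$ Then: (i) if $\alpha>\gamma$, the national AI performance gap satisfies $\Delta(S)\asymp S^{-q(\alpha-\gamma)}$; (ii) if $\alpha=\gamma$, scaling (increasing $S$) produces no asymptotic improvement of the gap beyond constant factors; (iii) if $\alpha<\gamma$, institutional entropy $D(S)$ grows faster than information injection $I(S)$, and the national AI system stagnates.
   Context: $S$ denotes the national AI scale (combining compute, talent, research intensity, capital and industrial adoption), $I(S)$ the information injection, $D(S)$ the institutional dissipation (also called institutional entropy), $\mathcal{P}(S)$ an aggregate AI capability index, and $\mathcal{P}_\infty$ a long-run frontier value of that index. The constant $\epsilon>0$ is a fixed regularizing constant in the denominator. The notation $f(S)\asymp g(S)$ means that $f$ and $g$ are of the same order for large $S$, i.e. there are constants $0<c_1\le c_2<\infty$ with $c_1g(S)\le f(S)\le c_2g(S)$ for all sufficiently large $S$. The word "stagnates" is informal: it is meant in the sense that the ratio $I(S)/(D(S)+\epsilon)$ decreases with scale and the gap $\Delta(S)$ fails to improve.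
   Formalization: Part (i) is proved for γ ≥ 0 only: for γ < 0, D(S) tends to 0, so the gap has order S^(-qα) and (i) is false (e.g. a=b=ε=q=1, α=1, γ=-1). In (iii) the ratio I/(D+ε) is shown to decrease for all sufficiently large S, since for α > 0 it increases at small S. *)

theory Defs
  imports Complex_Main "HOL-Library.Landau_Symbols"
begin

text \<open>
  Unlike membership in the library's \<open>\<Theta>(g)\<close>, this is one-signed: no absolute values are taken,
  so for eventually positive \<open>g\<close> it forces \<open>f\<close> to be eventually positive.
\<close>
definition same_order :: "(real \<Rightarrow> real) \<Rightarrow> (real \<Rightarrow> real) \<Rightarrow> bool"  (infix \<open>\<asymp>\<close> 50) where
  "f \<asymp> g \<longleftrightarrow>
     (\<exists>c\<^sub>1 c\<^sub>2. 0 < c\<^sub>1 \<and> c\<^sub>1 \<le> c\<^sub>2 \<and> (\<forall>\<^sub>F S in at_top. c\<^sub>1 * g S \<le> f S \<and> f S \<le> c\<^sub>2 * g S))"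

text \<open>
  Enlarging the scale from any sufficiently large \<open>S\<close> to any \<open>S' \<ge> S\<close> shrinks the gap
  by at most a fixed factor. The notion is meant for eventually positive gaps.
\<close>
definition no_improvement_beyond_constants :: "(real \<Rightarrow> real) \<Rightarrow> bool" where
  "no_improvement_beyond_constants \<Delta> \<longleftrightarrow>
     (\<exists>c>0. \<forall>\<^sub>F S in at_top. \<forall>S'\<ge>S. c * \<Delta> S \<le> \<Delta> S')"

text \<open>
  The efficiency ratio \<open>r\<close> decreases at large scales (for small scales the regularizing constant
  in its denominator can make it increase), and the gap fails to improve: the loss-free statement
  that no gap value already attained is eventually undercut is required
  in addition to the uniform bound up to constants.
\<close>
definition stagnates :: "(real \<Rightarrow> real) \<Rightarrow> (real \<Rightarrow> real) \<Rightarrow> bool" where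
  "stagnates r \<Delta> \<longleftrightarrow>
     (\<exists>S\<^sub>0>0. strict_antimono_on {S\<^sub>0..} r) \<and>
     no_improvement_beyond_constants \<Delta> \<and>
     (\<forall>S\<^sub>0>0. \<forall>\<^sub>F S in at_top. \<Delta> S\<^sub>0 \<le> \<Delta> S)"

end

theory Submission
  imports Defs "HOL-Real_Asymp.Real_Asymp"
begin

text \<open>
  For \<open>S > 0\<close> the ratio \<open>I(S) / (D(S) + \<epsilon>)\<close> is \<open>a / h(S)\<close> with
  \<open>h(S) = b S\<^bsup>\<gamma>-\<alpha>\<^esup> + \<epsilon> S\<^bsup>-\<alpha>\<^esup>\<close>, so the gap is of order \<open>(h(S) / a)\<^bsup>q\<^esup>\<close>.
  If \<open>\<gamma> \<ge> 0\<close>, the first term of \<open>h\<close> dominates. If \<open>\<alpha> < \<gamma>\<close>, then \<open>h\<close> tends to infinity, and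
  it is eventually strictly increasing because
  \<open>h'(S) = S\<^bsup>-\<alpha>-1\<^esup> (b (\<gamma>-\<alpha>) S\<^bsup>\<gamma>\<^esup> - \<alpha> \<epsilon>)\<close>; here either \<open>\<gamma> > 0\<close> and \<open>S\<^bsup>\<gamma>\<^esup>\<close> is unbounded,
  or \<open>\<alpha> < \<gamma> \<le> 0\<close> and both terms are positive.
\<close>

definition inverse_efficiency :: "real \<Rightarrow> real \<Rightarrow> real \<Rightarrow> real \<Rightarrow> real \<Rightarrow> real" where
  "inverse_efficiency b \<epsilon> \<alpha> \<gamma> S = b * S powr (\<gamma> - \<alpha>) + \<epsilon> * S powr (- \<alpha>)"

section \<open>Comparison up to constants and what it preserves\<close>

lemma same_order_trans:
  assumes "f \<asymp> g" and "g \<asymp> h"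
  shows "f \<asymp> h"
proof -
  obtain c1 c2 where c: "0 < c1" "c1 \<le> c2"
    and fg: "\<forall>\<^sub>F S in at_top. c1 * g S \<le> f S \<and> f S \<le> c2 * g S"
    using assms(1) unfolding same_order_def by blast
  obtain d1 d2 where d: "0 < d1" "d1 \<le> d2"
    and gh: "\<forall>\<^sub>F S in at_top. d1 * h S \<le> g S \<and> g S \<le> d2 * h S"
    using assms(2) unfolding same_order_def by blast
  have "\<forall>\<^sub>F S in at_top. (c1 * d1) * h S \<le> f S \<and> f S \<le> (c2 * d2) * h S"
    using fg gh
  proof eventually_elim
    case (elim S)
    have "c1 * (d1 * h S) \<le> c1 * g S" and "c2 * g S \<le> c2 * (d2 * h S)"
      using elim c by (auto intro!: mult_left_mono)
    with elim show ?case by (simp add: mult.assoc)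
  qed
  moreover have "0 < c1 * d1" and "c1 * d1 \<le> c2 * d2"
    using c d by (auto intro!: mult_mono)
  ultimately show ?thesis unfolding same_order_def by blast
qed

lemma same_order_cong_right:
  assumes "f \<asymp> g" and "\<forall>\<^sub>F S in at_top. g S = h S"
  shows "f \<asymp> h"
proof (rule same_order_trans [OF assms(1)])
  have "\<forall>\<^sub>F S in at_top. 1 * h S \<le> g S \<and> g S \<le> 1 * h S"
    using assms(2) by eventually_elim simp
  then show "g \<asymp> h"
    unfolding same_order_def using zero_less_one order_refl by blast
qed

text \<open>Serves to pass from an explicit model of the gap to the gap itself, which is known only
  up to constants.\<close>

lemma no_improvement_beyond_constants_same_order:
  assumes "f \<asymp> g" and "no_improvement_beyond_constants g"
  shows "no_improvement_beyond_constants f"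
proof -
  obtain c1 c2 where c: "0 < c1" "c1 \<le> c2"
    and fg: "\<forall>\<^sub>F S in at_top. c1 * g S \<le> f S \<and> f S \<le> c2 * g S"
    using assms(1) unfolding same_order_def by blast
  obtain k where k: "k > 0" and g: "\<forall>\<^sub>F S in at_top. \<forall>S'\<ge>S. k * g S \<le> g S'"
    using assms(2) unfolding no_improvement_beyond_constants_def by blast
  \<comment> \<open>Replacing \<open>f S\<close> by \<open>g S\<close> costs 1/c2, moving from
    \<open>S\<close> to \<open>S'\<close> costs k, and returning from \<open>g S'\<close> to
    \<open>f S'\<close> costs c1.\<close>
  define m where "m = c1 * k / c2"
  have "m > 0" using c k by (simp add: m_def)
  \<comment> \<open>The comparison of \<open>f\<close> with \<open>g\<close> is needed at
    \<open>S\<close> and at every later \<open>S'\<close>, so it is first strengthened to hold from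
    \<open>S\<close> onwards.\<close>
  moreover have "\<forall>\<^sub>F S in at_top. \<forall>S'\<ge>S. m * f S \<le> f S'"
    using eventually_all_ge_at_top [OF fg] g
  proof eventually_elim
    case (elim S)
    show ?case
    proof (intro allI impI)
      fix S' assume "S' \<ge> S"
      have "m * f S \<le> m * (c2 * g S)"
        using elim(1) \<open>m > 0\<close> by (intro mult_left_mono) auto
      also have "\<dots> = c1 * (k * g S)" using c by (simp add: m_def)
      also have "\<dots> \<le> c1 * g S'"
        using elim(2) \<open>S' \<ge> S\<close> c by (intro mult_left_mono) auto
      also have "\<dots> \<le> f S'" using elim(1) \<open>S' \<ge> S\<close> by blast
      finally show "m * f S \<le> f S'" .
    qed
  qed
  ultimately show ?thesis unfolding no_improvement_beyond_constants_def by blast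
qed

lemma no_improvement_beyond_constants_mono_on:
  assumes "mono_on {S\<^sub>0..} f"
  shows "no_improvement_beyond_constants f"
proof -
  have "\<forall>\<^sub>F S in at_top. \<forall>S'\<ge>S. 1 * f S \<le> f S'"
    using eventually_ge_at_top [of S\<^sub>0]
    by eventually_elim (auto intro: mono_onD [OF assms])
  then show ?thesis
    unfolding no_improvement_beyond_constants_def using zero_less_one by blast
qed

lemma same_order_filterlim_at_top:
  assumes "f \<asymp> g" and "filterlim g at_top at_top"
  shows "filterlim f at_top at_top"
proof -
  obtain c1 c2 where c: "0 < c1"
    and fg: "\<forall>\<^sub>F S in at_top. c1 * g S \<le> f S \<and> f S \<le> c2 * g S"
    using assms(1) unfolding same_order_def by blast
  have "filterlim (\<lambda>S. c1 * g S) at_top at_top"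
    using c assms(2) by (intro filterlim_tendsto_pos_mult_at_top [OF tendsto_const])
  then show ?thesis
    by (rule filterlim_at_top_mono) (use fg in eventually_elim, simp)
qed

text \<open>For q \<ge> 0 the power map is nondecreasing on nonnegative reals; the sign condition on
  \<open>g\<close> places the chain of bounds there, and the constants get raised to the power
  q.\<close>

lemma same_order_powr:
  assumes "f \<asymp> g" and "\<forall>\<^sub>F S in at_top. g S \<ge> 0" and "q \<ge> 0"
  shows "(\<lambda>S. f S powr q) \<asymp> (\<lambda>S. g S powr q)"
proof -
  obtain c1 c2 where c: "0 < c1" "c1 \<le> c2"
    and fg: "\<forall>\<^sub>F S in at_top. c1 * g S \<le> f S \<and> f S \<le> c2 * g S"
    using assms(1) unfolding same_order_def by blast
  have "\<forall>\<^sub>F S in at_top. c1 powr q * g S powr q \<le> f S powr q \<and>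
      f S powr q \<le> c2 powr q * g S powr q"
    using fg assms(2)
  proof eventually_elim
    case (elim S)
    have "0 \<le> c1 * g S" using c elim by simp
    with elim have "(c1 * g S) powr q \<le> f S powr q" "f S powr q \<le> (c2 * g S) powr q"
      using assms(3) by (auto intro!: powr_mono2)
    then show ?case using c elim by (simp add: powr_mult)
  qed
  moreover have "0 < c1 powr q" and "c1 powr q \<le> c2 powr q"
    using c assms(3) by (auto intro: powr_mono2)
  ultimately show ?thesis unfolding same_order_def by blast
qed

section \<open>Size, growth and monotonicity of the inverse efficiency\<close>

lemma inverse_efficiency_pos:
  assumes "b > 0" and "\<epsilon> > 0" and "S > 0"
  shows "inverse_efficiency b \<epsilon> \<alpha> \<gamma> S > 0"
  using assms by (simp add: inverse_efficiency_def add_pos_pos)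

lemma efficiency_ratio_eq:
  fixes a b \<epsilon> S :: real
  assumes "b > 0" and "\<epsilon> > 0" and "S > 0"
  shows "a * S powr \<alpha> / (b * S powr \<gamma> + \<epsilon>) = a / inverse_efficiency b \<epsilon> \<alpha> \<gamma> S"
proof -
  have "b * S powr \<gamma> + \<epsilon> = S powr \<alpha> * inverse_efficiency b \<epsilon> \<alpha> \<gamma> S"
    using assms(3)
    by (simp add: inverse_efficiency_def distrib_left powr_diff powr_minus field_simps)
  then show ?thesis using assms(3) by simp
qed

text \<open>For S \<ge> 1 and \<gamma> \<ge> 0 the \<epsilon>-term lies between 0 and \<epsilon>
  times the power in the first term, whence the constants b/a and (b + \<epsilon>)/a.\<close>

lemma inverse_efficiency_same_order:
  assumes "a > 0" and "b > 0" and "\<epsilon> > 0" and "\<gamma> \<ge> 0"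
  shows "(\<lambda>S. inverse_efficiency b \<epsilon> \<alpha> \<gamma> S / a) \<asymp> (\<lambda>S. S powr (\<gamma> - \<alpha>))"
proof -
  have "\<forall>\<^sub>F S in at_top. b / a * S powr (\<gamma> - \<alpha>) \<le> inverse_efficiency b \<epsilon> \<alpha> \<gamma> S / a \<and>
      inverse_efficiency b \<epsilon> \<alpha> \<gamma> S / a \<le> (b + \<epsilon>) / a * S powr (\<gamma> - \<alpha>)"
    using eventually_ge_at_top [of 1]
  proof eventually_elim
    case (elim S)
    have "S powr (- \<alpha>) \<le> S powr (\<gamma> - \<alpha>)"
      using elim assms by (intro powr_mono) auto
    then have "\<epsilon> * S powr (- \<alpha>) \<le> \<epsilon> * S powr (\<gamma> - \<alpha>)"
      using assms by (intro mult_left_mono) auto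
    moreover have "0 \<le> \<epsilon> * S powr (- \<alpha>)" using assms by simp
    ultimately show ?case
      using assms by (auto simp: inverse_efficiency_def divide_right_mono distrib_right)
  qed
  moreover have "0 < b / a" and "b / a \<le> (b + \<epsilon>) / a"
    using assms by (auto intro: divide_right_mono)
  ultimately show ?thesis unfolding same_order_def by blast
qed

text \<open>The first term alone diverges, whatever the sign of \<gamma>, and the \<epsilon>-term
  only adds to it.\<close>

lemma filterlim_inverse_efficiency:
  assumes "b > 0" and "\<epsilon> > 0" and "\<alpha> < \<gamma>"
  shows "filterlim (inverse_efficiency b \<epsilon> \<alpha> \<gamma>) at_top at_top"
proof (rule filterlim_at_top_mono)
  show "filterlim (\<lambda>S. b * S powr (\<gamma> - \<alpha>)) at_top at_top"
    using assms by real_asymp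
  show "\<forall>\<^sub>F S in at_top. b * S powr (\<gamma> - \<alpha>) \<le> inverse_efficiency b \<epsilon> \<alpha> \<gamma> S"
    using assms by (simp add: inverse_efficiency_def)
qed

lemma inverse_efficiency_strict_mono_on:
  assumes "b > 0" and "\<epsilon> > 0" and "\<alpha> < \<gamma>"
  obtains S\<^sub>0 where "S\<^sub>0 > 0" and "strict_mono_on {S\<^sub>0..} (inverse_efficiency b \<epsilon> \<alpha> \<gamma>)"
proof -
  have "\<forall>\<^sub>F S in at_top. \<alpha> * \<epsilon> < b * (\<gamma> - \<alpha>) * S powr \<gamma>"
  proof (cases "\<gamma> > 0")
    case True
    then have "filterlim (\<lambda>S. b * (\<gamma> - \<alpha>) * S powr \<gamma>) at_top at_top"
      using assms by real_asymp
    then show ?thesis by (simp add: filterlim_at_top_dense)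
  next
    case False
    then have "\<alpha> * \<epsilon> < 0" using assms by (simp add: mult_neg_pos)
    moreover have "0 \<le> b * (\<gamma> - \<alpha>) * S powr \<gamma>" for S using assms by simp
    ultimately show ?thesis by (intro always_eventually allI) (rule less_le_trans)
  qed
  \<comment> \<open>The inequality is secured on a whole half line of positive reals, so that the
    derivative test applies to every interval beyond \<open>S\<^sub>0\<close>.\<close>
  then have "\<forall>\<^sub>F S in at_top. S > 0 \<and> (\<forall>T\<ge>S. \<alpha> * \<epsilon> < b * (\<gamma> - \<alpha>) * T powr \<gamma>)"
    by (intro eventually_conj eventually_gt_at_top eventually_all_ge_at_top)
  then obtain S\<^sub>0 where S\<^sub>0: "S\<^sub>0 > 0" "\<And>T. T \<ge> S\<^sub>0 \<Longrightarrow> \<alpha> * \<epsilon> < b * (\<gamma> - \<alpha>) * T powr \<gamma>"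
    by (auto simp: eventually_at_top_linorder)
  have "strict_mono_on {S\<^sub>0..} (inverse_efficiency b \<epsilon> \<alpha> \<gamma>)"
  proof (rule strict_mono_onI)
    fix s t :: real
    assume "s \<in> {S\<^sub>0..}" and "s < t"
    show "inverse_efficiency b \<epsilon> \<alpha> \<gamma> s < inverse_efficiency b \<epsilon> \<alpha> \<gamma> t"
    proof (rule DERIV_pos_imp_increasing [OF \<open>s < t\<close>])
      fix T assume "s \<le> T"
      with \<open>s \<in> {S\<^sub>0..}\<close> have T: "T \<ge> S\<^sub>0" "T > 0" using S\<^sub>0(1) by auto
      \<comment> \<open>With the common positive power pulled out, the sign of the derivative is
        that of the bracket, which the choice of \<open>S\<^sub>0\<close> makes positive.\<close>
      let ?d = "T powr (- \<alpha> - 1) * (b * (\<gamma> - \<alpha>) * T powr \<gamma> - \<alpha> * \<epsilon>)"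
      have "T powr (- \<alpha> - 1) * T powr \<gamma> = T powr (\<gamma> - \<alpha> - 1)"
        by (simp flip: powr_add add: algebra_simps)
      then have d_eq: "?d = b * ((\<gamma> - \<alpha>) * T powr (\<gamma> - \<alpha> - 1)) + \<epsilon> * (- \<alpha> * T powr (- \<alpha> - 1))"
        by (simp add: algebra_simps)
      have "(inverse_efficiency b \<epsilon> \<alpha> \<gamma> has_real_derivative ?d) (at T)"
        unfolding inverse_efficiency_def [abs_def] d_eq
        by (intro DERIV_add DERIV_cmult has_real_derivative_powr T)
      moreover have "?d > 0" using S\<^sub>0(2) [OF T(1)] T(2) by simp
      ultimately show "\<exists>y. (inverse_efficiency b \<epsilon> \<alpha> \<gamma> has_real_derivative y) (at T) \<and> y > 0"
        by blast
    qed
  qed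
  with S\<^sub>0(1) show ?thesis by (rule that)
qed

text \<open>From 1 onwards the first term is the constant b, and the second has the exponent
  -\<gamma> \<ge> 0.\<close>

lemma inverse_efficiency_mono_on_diagonal:
  assumes "\<epsilon> > 0" and "\<gamma> \<le> 0"
  shows "mono_on {1..} (inverse_efficiency b \<epsilon> \<gamma> \<gamma>)"
  using assms
  by (auto intro!: mono_onI mult_left_mono powr_mono2 simp: inverse_efficiency_def)

text \<open>The two order claims carry \<gamma> \<ge> 0 because for \<gamma> < 0 the denominator
  tends to \<epsilon> and the gap has order \<open>S powr (- q * \<alpha>)\<close> instead. If
  \<alpha> = \<gamma> < 0, the gap then diverges, which still excludes improvement.\<close>

theorem proposition2:
  fixes a b \<alpha> \<gamma> \<epsilon> q P_inf :: real
    and I D P \<Delta> :: "real \<Rightarrow> real"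
  assumes "a > 0" and "b > 0" and "\<epsilon> > 0" and "q > 0"
    and "\<And>S. S > 0 \<Longrightarrow> I S = a * S powr \<alpha>"
    and "\<And>S. S > 0 \<Longrightarrow> D S = b * S powr \<gamma>"
    and "\<And>S. S > 0 \<Longrightarrow> \<Delta> S = P_inf - P S"
    and "\<Delta> \<asymp> (\<lambda>S. (I S / (D S + \<epsilon>)) powr (- q))"
  shows "(\<alpha> > \<gamma> \<longrightarrow> \<gamma> \<ge> 0 \<longrightarrow> \<Delta> \<asymp> (\<lambda>S. S powr (- q * (\<alpha> - \<gamma>)))) \<and>
         (\<alpha> = \<gamma> \<longrightarrow> no_improvement_beyond_constants \<Delta> \<and> (\<gamma> \<ge> 0 \<longrightarrow> \<Delta> \<asymp> (\<lambda>S. 1))) \<and>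
         (\<alpha> < \<gamma> \<longrightarrow> I \<in> o[at_top](D) \<and> stagnates (\<lambda>S. I S / (D S + \<epsilon>)) \<Delta>)"
proof -
  define h where "h = inverse_efficiency b \<epsilon> \<alpha> \<gamma>"
  define g where "g = (\<lambda>S. (h S / a) powr q)"
  have h_pos: "h S > 0" if "S > 0" for S
    using inverse_efficiency_pos assms(2,3) that by (simp add: h_def)
  have ratio: "I S / (D S + \<epsilon>) = a / h S" if "S > 0" for S
    using efficiency_ratio_eq [OF assms(2,3) that] assms(5,6) that by (simp add: h_def)
  \<comment> \<open>The negative exponent inverts a/h into h/a; the power laws for \<open>I\<close>
    and \<open>D\<close> are available only at positive scales, so the equality is an eventual
    one.\<close>
  have "\<forall>\<^sub>F S in at_top. (I S / (D S + \<epsilon>)) powr (- q) = g S"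
    using eventually_gt_at_top [of 0]
  proof eventually_elim
    case (elim S)
    then show ?case
      using assms(1) h_pos [OF elim]
      by (simp add: ratio g_def powr_minus powr_divide)
  qed
  with assms(8) have \<Delta>: "\<Delta> \<asymp> g" by (rule same_order_cong_right)
  have g_mono: "mono_on {S\<^sub>0..} g" if "S\<^sub>0 > 0" and "mono_on {S\<^sub>0..} h" for S\<^sub>0
  proof (rule mono_onI)
    fix s t assume st: "s \<in> {S\<^sub>0..}" "t \<in> {S\<^sub>0..}" "s \<le> t"
    then have "h s \<le> h t" and "h s > 0"
      using that h_pos by (auto intro: mono_onD)
    then show "g s \<le> g t"
      unfolding g_def using assms(1,4) by (intro powr_mono2 divide_right_mono) auto
  qed
  have \<Delta>_powr: "\<Delta> \<asymp> (\<lambda>S. S powr (- q * (\<alpha> - \<gamma>)))" if "\<gamma> \<ge> 0"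
  proof -
    have "g \<asymp> (\<lambda>S. (S powr (\<gamma> - \<alpha>)) powr q)"
      unfolding g_def h_def using assms that
      by (intro same_order_powr inverse_efficiency_same_order) auto
    with \<Delta> have "\<Delta> \<asymp> (\<lambda>S. (S powr (\<gamma> - \<alpha>)) powr q)" by (rule same_order_trans)
    then show ?thesis by (simp add: powr_powr algebra_simps)
  qed
  have \<Delta>_one: "\<Delta> \<asymp> (\<lambda>S. 1)" if "\<alpha> = \<gamma>" and "\<gamma> \<ge> 0"
    using \<Delta>_powr [OF that(2)]
    by (rule same_order_cong_right)
      (use eventually_gt_at_top [of 0] in eventually_elim, simp add: that(1))
  have no_improvement: "no_improvement_beyond_constants \<Delta>" if "\<alpha> = \<gamma>"
  proof (cases "\<gamma> \<ge> 0")
    case True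
    have "no_improvement_beyond_constants (\<lambda>S. 1)"
      by (rule no_improvement_beyond_constants_mono_on [of 0]) (simp add: mono_onI)
    with \<Delta>_one [OF that True] show ?thesis
      by (rule no_improvement_beyond_constants_same_order)
  next
    \<comment> \<open>Here the gap is not of constant order; instead monotonicity of
      \<open>h\<close> makes the model \<open>g\<close> nondecreasing.\<close>
    case False
    then have "mono_on {1..} h"
      unfolding h_def that using assms(3) by (intro inverse_efficiency_mono_on_diagonal) auto
    then have "mono_on {1..} g" by (intro g_mono) auto
    then show ?thesis
      by (intro no_improvement_beyond_constants_same_order [OF \<Delta>]
          no_improvement_beyond_constants_mono_on)
  qed
  have small: "I \<in> o[at_top](D)" if "\<alpha> < \<gamma>"
  proof -
    have "(\<lambda>S. a * S powr \<alpha>) \<in> o[at_top](\<lambda>S. b * S powr \<gamma>)"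
      using assms(1,2) that by real_asymp
    also have "?this \<longleftrightarrow> ?thesis"
      by (intro landau_o.small.cong_ex eventually_mono [OF eventually_gt_at_top [of 0]])
        (simp_all add: assms(5,6))
    finally show ?thesis .
  qed
  have "stagnates (\<lambda>S. I S / (D S + \<epsilon>)) \<Delta>" if "\<alpha> < \<gamma>"
  proof -
    obtain S\<^sub>0 where S\<^sub>0: "S\<^sub>0 > 0" "strict_mono_on {S\<^sub>0..} h"
      unfolding h_def using inverse_efficiency_strict_mono_on assms(2,3) \<open>\<alpha> < \<gamma>\<close> by metis
    have "strict_antimono_on {S\<^sub>0..} (\<lambda>S. I S / (D S + \<epsilon>))"
    proof (rule monotone_onI)
      fix s t assume st: "s \<in> {S\<^sub>0..}" "t \<in> {S\<^sub>0..}" "s < t"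
      then have "h s < h t" by (rule strict_mono_onD [OF S\<^sub>0(2)])
      then show "I s / (D s + \<epsilon>) > I t / (D t + \<epsilon>)"
        using st S\<^sub>0(1) h_pos [of s] assms(1) by (simp add: ratio divide_strict_left_mono)
    qed
    moreover have "no_improvement_beyond_constants \<Delta>"
      using S\<^sub>0
      by (intro no_improvement_beyond_constants_same_order [OF \<Delta>]
          no_improvement_beyond_constants_mono_on g_mono strict_mono_on_imp_mono_on)
    \<comment> \<open>Monotonicity of \<open>g\<close> bounds the gap only up to constants. The
      loss-free clause of \<open>stagnates\<close> comes from divergence: a gap tending to infinity
      eventually exceeds each value \<open>\<Delta> S\<^sub>0\<close>.\<close>
    moreover have "filterlim \<Delta> at_top at_top"
    proof (rule same_order_filterlim_at_top [OF \<Delta>])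
      have "filterlim h at_top at_top"
        unfolding h_def using assms(2,3) that by (rule filterlim_inverse_efficiency)
      moreover have "filterlim (\<lambda>x. (x / a) powr q) at_top at_top"
        using assms(1,4) by real_asymp
      ultimately show "filterlim g at_top at_top"
        unfolding g_def by (rule filterlim_compose [rotated])
    qed
    ultimately show ?thesis
      unfolding stagnates_def using S\<^sub>0(1) by (auto simp: filterlim_at_top)
  qed
  with \<Delta>_powr \<Delta>_one no_improvement small show ?thesis by blast
qed

end
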